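(* Let $G$ be a finitely generated LERF group with positive rank gradient $\nabla G>0$, and let $A,B$ be finitely generated subgroups of infinite index in $G$. Then there exists a finite index subgroup $H$ of $B$ such that the subgroup $\langle A\cup H\rangle$ generated by $A$ and $H$ has infinite index in $G$.
   Context: For a group $U$, $d(U)$ denotes the minimal cardinality of a generating set of $U$. The rank gradient of a finitely generated group $G$ is $\nabla G=\inf_U \frac{d(U)-1}{[G:U]}$, where $U$ ranges over all finite index subgroups of $G$. A group $G$ is LERF (subgroup separable) if every finitely generated subgroup of $G$ is the intersection of some collection of finite index subgroups of $G$. *)

theory Defs
  imports "HOL-Algebra.Algebra" "HOL-Analysis.Analysis"
begin

definition fin_index_in :: "('a, 'b) monoid_scheme \<Rightarrow> 'a set \<Rightarrow> 'a set \<Rightarrow> bool" where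
  "fin_index_in G K H \<longleftrightarrow> finite (rcosets\<^bsub>G\<lparr>carrier := K\<rparr>\<^esub> H)"

definition grp_index :: "('a, 'b) monoid_scheme \<Rightarrow> 'a set \<Rightarrow> nat" where
  "grp_index G H = card (rcosets\<^bsub>G\<^esub> H)"

definition fin_index :: "('a, 'b) monoid_scheme \<Rightarrow> 'a set \<Rightarrow> bool" where
  "fin_index G H \<longleftrightarrow> finite (rcosets\<^bsub>G\<^esub> H)"

definition fg_subgroup :: "('a, 'b) monoid_scheme \<Rightarrow> 'a set \<Rightarrow> bool" where
  "fg_subgroup G U \<longleftrightarrow> subgroup U G \<and> (\<exists>S. finite S \<and> S \<subseteq> U \<and> generate G S = U)"

definition fg_group :: "('a, 'b) monoid_scheme \<Rightarrow> bool" where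
  "fg_group G \<longleftrightarrow> fg_subgroup G (carrier G)"

definition min_gens :: "('a, 'b) monoid_scheme \<Rightarrow> 'a set \<Rightarrow> nat" where
  "min_gens G U = (LEAST n. \<exists>S. finite S \<and> S \<subseteq> U \<and> card S = n \<and> generate G S = U)"

definition rank_gradient :: "('a, 'b) monoid_scheme \<Rightarrow> real" where
  "rank_gradient G = Inf {(real (min_gens G U) - 1) / real (grp_index G U) | U.
                          subgroup U G \<and> fin_index G U}"

definition LERF :: "('a, 'b) monoid_scheme \<Rightarrow> bool" where
  "LERF G \<longleftrightarrow> (\<forall>H. fg_subgroup G H \<longrightarrow>
      (\<exists>\<K>. (\<forall>K\<in>\<K>. subgroup K G \<and> fin_index G K) \<and> H = carrier G \<inter> \<Inter>\<K>))"

end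

theory Submission
  imports Defs
begin

text \<open>
  Write \<open>\<rho>\<close> for the rank gradient. LERF makes a finitely generated subgroup of infinite index
  contained in finite index subgroups of arbitrarily large index, and a finite index subgroup
  needing fewer than \<open>\<rho> n\<close> generators has index less than \<open>n\<close>. Take \<open>U \<supseteq> A\<close> and \<open>V \<supseteq> B\<close>
  of large index. By Schreier's bound \<open>A' = A \<inter> V\<close> and \<open>B' = B \<inter> U\<close> need few generators
  compared with \<open>[G : U \<inter> V]\<close>, so \<open>C = \<langle>A', B'\<rangle>\<close> has infinite index. To recover all of \<open>A\<close>,
  choose \<open>K \<supseteq> C\<close> of huge finite index and a normal finite index subgroup \<open>N \<subseteq> K\<close>. The product
  \<open>N A B\<close> lies in boundedly many sets \<open>a K b\<close>, hence occupies a tiny proportion of the cosets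
  of \<open>N\<close>. So \<open>H = B \<inter> N A\<close> has index in \<open>B\<close> much smaller than \<open>[G : N A]\<close>, and
  \<open>\<langle>A, H\<rangle> \<subseteq> N A\<close> has too few generators to have finite index.
\<close>

section \<open>Cosets met by a set, and index arithmetic\<close>

text \<open>On \<open>Z\<close> the map \<open>g\<close> factors through \<open>f\<close>, as one
  sees by choosing a preimage in \<open>Z\<close> for each value of \<open>f\<close>. With coset
  maps as \<open>f\<close> and \<open>g\<close> this compares indices without naming a map between
  coset spaces.\<close>

lemma image_factor:
  assumes "\<And>x y. \<lbrakk>x \<in> Z; y \<in> Z; f x = f y\<rbrakk> \<Longrightarrow> g x = g y" and "finite (f ` Z)"
  shows finite_image_factor: "finite (g ` Z)"
    and card_image_factor: "card (g ` Z) \<le> card (f ` Z)"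
proof -
  have "g x = g (inv_into Z f (f x))" if "x \<in> Z" for x
    using that by (intro assms(1)) (auto simp: inv_into_into f_inv_into_f)
  then have "g ` Z \<subseteq> (\<lambda>p. g (inv_into Z f p)) ` (f ` Z)" by blast
  with assms(2) show "finite (g ` Z)" "card (g ` Z) \<le> card (f ` Z)"
    by (auto intro: finite_surj surj_card_le)
qed

text \<open>For a subgroup \<open>Z\<close> containing \<open>H\<close> this is the index [Z : H].
  Arbitrary \<open>Z\<close> are allowed because later \<open>Z\<close> is a subgroup not containing
  \<open>H\<close>, or the product N A B. Infinitely many cosets give the value 0, so inequalities
  need finiteness.\<close>

definition coset_count :: "('a, 'b) monoid_scheme \<Rightarrow> 'a set \<Rightarrow> 'a set \<Rightarrow> nat" where
  "coset_count G H Z = card ((\<lambda>x. H #>\<^bsub>G\<^esub> x) ` Z)"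

lemma grp_index_eq_coset_count: "grp_index G H = coset_count G H (carrier G)"
  unfolding grp_index_def coset_count_def RCOSETS_def by (rule arg_cong[of _ _ card]) auto

lemma fin_index_iff: "fin_index G H \<longleftrightarrow> finite ((\<lambda>x. H #>\<^bsub>G\<^esub> x) ` carrier G)"
  unfolding fin_index_def RCOSETS_def by (rule arg_cong[of _ _ finite]) auto

lemma fin_index_in_iff: "fin_index_in G B H \<longleftrightarrow> finite ((\<lambda>x. H #>\<^bsub>G\<^esub> x) ` B)"
  unfolding fin_index_in_def RCOSETS_def r_coset_def
  by (rule arg_cong[of _ _ finite]) auto

context group
begin

lemma rcos_eq_iff:
  assumes "subgroup H G" "x \<in> carrier G" "y \<in> carrier G"
  shows "H #> x = H #> y \<longleftrightarrow> x \<otimes> inv y \<in> H"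
proof
  assume "H #> x = H #> y"
  then have "x \<in> H #> y" using rcos_self assms by blast
  then obtain h where "h \<in> H" "x = h \<otimes> y" unfolding r_coset_def by blast
  then show "x \<otimes> inv y \<in> H"
    using assms by (simp add: m_assoc subgroup.mem_carrier)
next
  assume h: "x \<otimes> inv y \<in> H"
  have "x = (x \<otimes> inv y) \<otimes> y" using assms by (simp add: m_assoc)
  with h have "x \<in> H #> y" unfolding r_coset_def by blast
  then show "H #> x = H #> y" using repr_independence assms by metis
qed

lemma rcos_eq_mono:
  assumes "subgroup H G" "subgroup K G" "H \<subseteq> K" "x \<in> carrier G" "y \<in> carrier G"
    and "H #> x = H #> y"
  shows "K #> x = K #> y"
  using assms rcos_eq_iff by blast

lemma finite_rcos_antimono:
  assumes "subgroup H G" "subgroup K G" "H \<subseteq> K" "Z \<subseteq> carrier G"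
    and "finite ((\<lambda>x. H #> x) ` Z)"
  shows "finite ((\<lambda>x. K #> x) ` Z)"
  using rcos_eq_mono[OF assms(1-3)] assms(4) by (intro finite_image_factor[OF _ assms(5)]) blast

lemma coset_count_antimono:
  assumes "subgroup H G" "subgroup K G" "H \<subseteq> K" "Z \<subseteq> carrier G"
    and "finite ((\<lambda>x. H #> x) ` Z)"
  shows "coset_count G K Z \<le> coset_count G H Z"
  unfolding coset_count_def
  using rcos_eq_mono[OF assms(1-3)] assms(4) by (intro card_image_factor[OF _ assms(5)]) blast

lemma coset_count_mono:
  assumes "finite ((\<lambda>x. H #> x) ` Y)" "Z \<subseteq> Y"
  shows "coset_count G H Z \<le> coset_count G H Y"
  unfolding coset_count_def using assms by (intro card_mono) auto

lemma finite_rcos_subset: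
  assumes "fin_index G H" "Z \<subseteq> carrier G"
  shows "finite ((\<lambda>x. H #> x) ` Z)"
  using assms unfolding fin_index_iff by (meson finite_subset image_mono)

text \<open>For x, y in \<open>B\<close> the quotient x y^-1 already lies in \<open>B\<close>, so
  membership in \<open>B \<inter> V\<close> and in \<open>V\<close> agree: both coset relations
  coincide on \<open>B\<close>.\<close>

lemma coset_count_Int:
  assumes "subgroup B G" "subgroup V G"
  shows "coset_count G (B \<inter> V) B = coset_count G V B"
    and "finite ((\<lambda>x. (B \<inter> V) #> x) ` B) \<longleftrightarrow> finite ((\<lambda>x. V #> x) ` B)"
proof -
  have eq: "(B \<inter> V) #> x = (B \<inter> V) #> y \<longleftrightarrow> V #> x = V #> y" if "x \<in> B" "y \<in> B" for x y
    using that assms subgroup.mem_carrier[OF assms(1)]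
    by (simp add: rcos_eq_iff subgroups_Inter_pair subgroup.m_closed subgroup.m_inv_closed)
  show fin: "finite ((\<lambda>x. (B \<inter> V) #> x) ` B) \<longleftrightarrow> finite ((\<lambda>x. V #> x) ` B)"
    by (metis (no_types, lifting) eq finite_image_factor)
  show "coset_count G (B \<inter> V) B = coset_count G V B"
  proof (cases "finite ((\<lambda>x. V #> x) ` B)")
    case True
    then show ?thesis unfolding coset_count_def
      by (intro antisym card_image_factor) (use fin eq in auto)
  next
    case False
    with fin show ?thesis unfolding coset_count_def by simp
  qed
qed

text \<open>The tower law, for a set that is a union of right cosets of \<open>U\<close>. With a
  representative \<open>r Q\<close> in \<open>Z\<close> for each such coset \<open>Q\<close>, every
  coset of \<open>N\<close> in \<open>Z\<close> is (N u) r(Q) for exactly one pair of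
  \<open>Q\<close> and N u.\<close>

lemma coset_count_mult:
  assumes N: "subgroup N G" and U: "subgroup U G" and "N \<subseteq> U" and Z: "Z \<subseteq> carrier G"
    and UZ: "\<And>u x. \<lbrakk>u \<in> U; x \<in> Z\<rbrakk> \<Longrightarrow> u \<otimes> x \<in> Z"
  shows "coset_count G N Z = coset_count G U Z * coset_count G N U"
proof -
  define r where "r = inv_into Z (\<lambda>x. U #> x)"
  have r: "r Q \<in> Z" "r Q \<in> carrier G" "U #> r Q = Q" if "Q \<in> (\<lambda>x. U #> x) ` Z" for Q
    using that Z unfolding r_def by (auto simp: inv_into_into f_inv_into_f[of _ "\<lambda>x. U #> x"] subset_iff)
  have Uc: "u \<in> carrier G" if "u \<in> U" for u using that subgroup.mem_carrier[OF U] by blast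
  have Nc: "N \<subseteq> carrier G" using subgroup.subset[OF N] .
  let ?f = "\<lambda>(Q, p). p #> r Q"
  have "bij_betw ?f (((\<lambda>x. U #> x) ` Z) \<times> ((\<lambda>x. N #> x) ` U)) ((\<lambda>x. N #> x) ` Z)"
    unfolding bij_betw_def
  proof
    have inj: "Q = Q' \<and> N #> u = N #> u'"
      if Q: "Q \<in> (\<lambda>x. U #> x) ` Z" "Q' \<in> (\<lambda>x. U #> x) ` Z" and u: "u \<in> U" "u' \<in> U"
        and e: "(N #> u) #> r Q = (N #> u') #> r Q'" for Q Q' u u'
    proof -
      have "N #> (u \<otimes> r Q) = N #> (u' \<otimes> r Q')"
        using e Q u r Uc Nc by (simp add: coset_mult_assoc)
      \<comment> \<open>Enlarging \<open>N\<close> to \<open>U\<close> absorbs \<open>u\<close>,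
        which recovers \<open>Q\<close>; cancelling \<open>r Q\<close> on the right then recovers N
        u.\<close>
      then have "U #> (u \<otimes> r Q) = U #> (u' \<otimes> r Q')"
        using rcos_eq_mono[OF N U \<open>N \<subseteq> U\<close>] Q u r Uc by simp
      then have "(U #> u) #> r Q = (U #> u') #> r Q'"
        using Q u r Uc U by (simp add: coset_mult_assoc subgroup.subset)
      then have QQ: "Q = Q'"
        using Q u r U Uc by (simp add: coset_join2)
      have "(N #> u) #> r Q #> inv (r Q) = (N #> u') #> r Q #> inv (r Q)"
        using e QQ by simp
      then show ?thesis
        using QQ Q u r Uc Nc by (simp add: coset_mult_assoc m_assoc)
    qed
    show "inj_on ?f (((\<lambda>x. U #> x) ` Z) \<times> ((\<lambda>x. N #> x) ` U))"
    proof (rule inj_onI)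
      fix a b assume ab: "a \<in> ((\<lambda>x. U #> x) ` Z) \<times> ((\<lambda>x. N #> x) ` U)"
        "b \<in> ((\<lambda>x. U #> x) ` Z) \<times> ((\<lambda>x. N #> x) ` U)" and e: "?f a = ?f b"
      obtain Q u Q' u' where
        "Q \<in> (\<lambda>x. U #> x) ` Z" "u \<in> U" "a = (Q, N #> u)"
        "Q' \<in> (\<lambda>x. U #> x) ` Z" "u' \<in> U" "b = (Q', N #> u')"
        using ab by blast
      then show "a = b" using inj[of Q Q' u u'] e by simp
    qed
    show "?f ` (((\<lambda>x. U #> x) ` Z) \<times> ((\<lambda>x. N #> x) ` U)) = (\<lambda>x. N #> x) ` Z"
    proof (intro equalityI subsetI)
      fix p assume "p \<in> ?f ` (((\<lambda>x. U #> x) ` Z) \<times> ((\<lambda>x. N #> x) ` U))"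
      then obtain Q u where "Q \<in> (\<lambda>x. U #> x) ` Z" "u \<in> U" "p = (N #> u) #> r Q" by auto
      then show "p \<in> (\<lambda>x. N #> x) ` Z"
        using r Uc Nc UZ by (simp add: coset_mult_assoc)
    next
      fix p assume "p \<in> (\<lambda>x. N #> x) ` Z"
      then obtain x where x: "x \<in> Z" "p = N #> x" by auto
      let ?Q = "U #> x"
      have Q: "?Q \<in> (\<lambda>x. U #> x) ` Z" using x by blast
      have xc: "x \<in> carrier G" using x Z by blast
      have "x \<otimes> inv (r ?Q) \<in> U" using rcos_eq_iff[OF U xc, of "r ?Q"] r[OF Q] by simp
      moreover have "p = (N #> (x \<otimes> inv (r ?Q))) #> r ?Q"
        using x xc r[OF Q] Nc by (simp add: coset_mult_assoc m_assoc)
      ultimately show "p \<in> ?f ` (((\<lambda>x. U #> x) ` Z) \<times> ((\<lambda>x. N #> x) ` U))"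
        using Q by force
    qed
  qed
  from bij_betw_same_card[OF this] show ?thesis
    unfolding coset_count_def by (simp add: card_cartesian_product)
qed

lemma grp_index_mult:
  assumes "subgroup N G" "subgroup U G" "N \<subseteq> U"
  shows "grp_index G N = grp_index G U * coset_count G N U"
  unfolding grp_index_eq_coset_count
  using assms subgroup.mem_carrier[OF assms(2)] by (intro coset_count_mult) auto

lemma grp_index_pos:
  assumes "fin_index G H"
  shows "grp_index G H > 0"
  using assms unfolding grp_index_eq_coset_count coset_count_def fin_index_iff
  by (auto simp: card_gt_0_iff)

lemma fin_index_Int:
  assumes "subgroup U G" "subgroup V G" "fin_index G U" "fin_index G V"
  shows "fin_index G (U \<inter> V)"
  unfolding fin_index_iff
proof (rule finite_image_factor)
  show "finite ((\<lambda>x. (U #> x, V #> x)) ` carrier G)"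
    using assms(3,4) unfolding fin_index_iff
    by (rule_tac finite_subset[of _ "((\<lambda>x. U #> x) ` carrier G) \<times> ((\<lambda>x. V #> x) ` carrier G)"]) auto
qed (use assms in \<open>auto simp: rcos_eq_iff subgroups_Inter_pair\<close>)

section \<open>Transversals and normal cores\<close>

lemma finite_transversal:
  assumes H: "subgroup H G" and A: "subgroup A G" and "H \<subseteq> A" and "finite ((\<lambda>x. H #> x) ` A)"
  obtains R where "finite R" "R \<subseteq> A" "\<forall>x\<in>A. \<exists>h\<in>H. \<exists>a\<in>R. x = h \<otimes> a"
proof -
  define r where "r = inv_into A (\<lambda>x. H #> x)"
  let ?R = "r ` (\<lambda>x. H #> x) ` A"
  have r: "r (H #> x) \<in> A" "H #> r (H #> x) = H #> x" if "x \<in> A" for x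
    using that unfolding r_def by (auto simp: inv_into_into f_inv_into_f[of _ "\<lambda>x. H #> x"])
  show thesis
  proof
    show "finite ?R" using assms(4) by simp
    show "?R \<subseteq> A" using r by auto
    show "\<forall>x\<in>A. \<exists>h\<in>H. \<exists>a\<in>?R. x = h \<otimes> a"
    proof
      fix x assume x: "x \<in> A"
      have "x \<in> H #> r (H #> x)"
        using x r[OF x] rcos_self[OF _ H] subgroup.mem_carrier[OF A] by metis
      then show "\<exists>h\<in>H. \<exists>a\<in>?R. x = h \<otimes> a"
        using x unfolding r_coset_def by auto
    qed
  qed
qed

text \<open>The witness is the kernel of the action of \<open>G\<close> on the right cosets of
  \<open>K\<close> by right multiplication. Its index is finite because a finite set has finitely
  many self-maps.\<close>

lemma fin_index_normal_core:
  assumes K: "subgroup K G" and "fin_index G K"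
  obtains N where "N \<lhd> G" "N \<subseteq> K" "fin_index G N"
proof
  let ?N = "{g \<in> carrier G. \<forall>x\<in>carrier G. K #> (x \<otimes> g) = K #> x}"
  have Kc: "K \<subseteq> carrier G" using subgroup.subset[OF K] .
  have sub: "subgroup ?N G"
  proof (rule subgroupI)
    show "?N \<subseteq> carrier G" "?N \<noteq> {}" by auto
    fix a assume a: "a \<in> ?N"
    have "K #> (x \<otimes> inv a) = K #> x" if "x \<in> carrier G" for x
    proof -
      have "K #> ((x \<otimes> inv a) \<otimes> a) = K #> (x \<otimes> inv a)" using a that by blast
      then show ?thesis using a that by (simp add: m_assoc)
    qed
    then show "inv a \<in> ?N" using a by simp
    fix b assume b: "b \<in> ?N"
    have "K #> (x \<otimes> (a \<otimes> b)) = K #> x" if "x \<in> carrier G" for x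
      using a b that by (simp add: m_assoc[symmetric])
    then show "a \<otimes> b \<in> ?N" using a b by simp
  qed
  show "?N \<lhd> G"
    unfolding normal_inv_iff
  proof (intro conjI ballI sub)
    fix x h assume x: "x \<in> carrier G" and h: "h \<in> ?N"
    have "K #> (y \<otimes> (x \<otimes> h \<otimes> inv x)) = K #> y" if y: "y \<in> carrier G" for y
    proof -
      have "K #> (y \<otimes> (x \<otimes> h \<otimes> inv x)) = (K #> ((y \<otimes> x) \<otimes> h)) #> inv x"
        using x y h Kc by (simp add: coset_mult_assoc m_assoc)
      also have "K #> ((y \<otimes> x) \<otimes> h) = K #> (y \<otimes> x)"
        using h x y by blast
      finally show ?thesis using x y Kc by (simp add: coset_mult_assoc m_assoc)
    qed
    then show "x \<otimes> h \<otimes> inv x \<in> ?N" using x h by simp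
  qed
  show "?N \<subseteq> K"
  proof
    fix g assume g: "g \<in> ?N"
    then have "K #> (\<one> \<otimes> g) = K #> \<one>" by blast
    with g show "g \<in> K" using rcos_eq_iff[OF K, of g \<one>] by simp
  qed
  show "fin_index G ?N"
    unfolding fin_index_iff
  proof (rule finite_image_factor)
    let ?P = "(\<lambda>x. K #> x) ` carrier G"
    \<comment> \<open>The action of \<open>g\<close>, restricted to the coset set so that it lies in
      a finite extensional function space.\<close>
    let ?f = "\<lambda>g. \<lambda>p\<in>?P. p #> g"
    show "finite (?f ` carrier G)"
    proof (rule finite_subset)
      show "?f ` carrier G \<subseteq> ?P \<rightarrow>\<^sub>E ?P"
        using Kc by (auto simp: coset_mult_assoc)
      show "finite (?P \<rightarrow>\<^sub>E ?P)"
        using assms(2) unfolding fin_index_iff by (intro finite_PiE) auto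
    qed
    fix g h assume gh: "g \<in> carrier G" "h \<in> carrier G" and e: "?f g = ?f h"
    have "K #> (x \<otimes> (g \<otimes> inv h)) = K #> x" if x: "x \<in> carrier G" for x
    proof -
      have "(K #> x) #> g = (K #> x) #> h" using fun_cong[OF e, of "K #> x"] x by simp
      then have "(K #> x) #> g #> inv h = (K #> x) #> h #> inv h" by simp
      then show ?thesis using x gh Kc by (simp add: coset_mult_assoc m_assoc)
    qed
    then show "?N #> g = ?N #> h"
      using rcos_eq_iff[OF sub gh] gh by simp
  qed
qed

section \<open>Schreier generators and the rank gradient\<close>

text \<open>Schreier's lemma. The products of <Z> with the coset representatives contain 1 and are
  stable under right multiplication by \<open>S\<close> and its inverses, so they exhaust
  \<open>B\<close>; those lying in \<open>H\<close> have the representative of \<open>H\<close>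
  itself.\<close>

lemma schreier_generators:
  assumes H: "subgroup H G" and B: "subgroup B G" and HB: "H \<subseteq> B"
    and fin: "finite ((\<lambda>x. H #> x) ` B)"
    and S: "finite S" "S \<subseteq> B" "generate G S = B"
  obtains Z where "finite Z" "card Z \<le> coset_count G H B * card S" "generate G Z = H"
proof -
  \<comment> \<open>The trivial coset must be represented by 1: an element
    \<open>x \<otimes> r Q\<close> of \<open>H\<close> then has \<open>Q = H\<close> and equals
    \<open>x\<close>.\<close>
  define r where "r Q = (if Q = H then \<one> else inv_into B (\<lambda>x. H #> x) Q)" for Q
  let ?P = "(\<lambda>x. H #> x) ` B"
  have Bc: "x \<in> carrier G" if "x \<in> B" for x using that subgroup.mem_carrier[OF B] by blast
  have Hc: "H \<subseteq> carrier G" using subgroup.subset[OF H] .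
  have r: "r Q \<in> B" "H #> r Q = Q" if "Q \<in> ?P" for Q
    using that Hc subgroup.one_closed[OF B] unfolding r_def
    by (auto simp: inv_into_into f_inv_into_f[of _ "\<lambda>x. H #> x"])
  have HP: "H \<in> ?P" using Hc subgroup.one_closed[OF B] by (intro image_eqI[of _ _ \<one>]) auto
  let ?g = "\<lambda>(Q, s). r Q \<otimes> s \<otimes> inv (r (H #> (r Q \<otimes> s)))"
  define Z where "Z = ?g ` (?P \<times> S)"
  have gH: "?g (Q, s) \<in> H" if "Q \<in> ?P" "s \<in> S" for Q s
  proof -
    have "r Q \<otimes> s \<in> B" using r that S subgroup.m_closed[OF B] by blast
    then show ?thesis
      using rcos_eq_iff[OF H, of "r Q \<otimes> s" "r (H #> (r Q \<otimes> s))"] r[of "H #> (r Q \<otimes> s)"] Bc by simp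
  qed
  then have ZH: "Z \<subseteq> H" unfolding Z_def by auto
  then have Zc: "Z \<subseteq> carrier G" using Hc by blast
  let ?D = "{x \<otimes> r Q |x Q. x \<in> generate G Z \<and> Q \<in> ?P}"
  have gc: "x \<in> carrier G" if "x \<in> generate G Z" for x using that generate_in_carrier Zc by blast
  have right: "d \<otimes> s \<in> ?D" if d: "d \<in> ?D" and s: "s \<in> S" for d s
  proof -
    obtain x Q where x: "x \<in> generate G Z" "Q \<in> ?P" "d = x \<otimes> r Q" using d by blast
    let ?Q = "H #> (r Q \<otimes> s)"
    have "r Q \<otimes> s \<in> B" using r x s S subgroup.m_closed[OF B] by blast
    then have Q: "?Q \<in> ?P" by blast
    have "?g (Q, s) \<in> generate G Z" using x s unfolding Z_def by (intro generate.incl) blast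
    then have "x \<otimes> ?g (Q, s) \<in> generate G Z" using x by (auto intro: generate.eng)
    moreover have "d \<otimes> s = (x \<otimes> ?g (Q, s)) \<otimes> r ?Q"
      using x gc r[OF Q] r[OF x(2)] Bc s S by (simp add: m_assoc subset_iff)
    ultimately show ?thesis using Q by blast
  qed
  have rightinv: "d \<otimes> inv s \<in> ?D" if d: "d \<in> ?D" and s: "s \<in> S" for d s
  proof -
    obtain x Q where x: "x \<in> generate G Z" "Q \<in> ?P" "d = x \<otimes> r Q" using d by blast
    have sB: "s \<in> B" using s S by blast
    \<comment> \<open>Multiplication by \<open>s\<close> sends this coset back to \<open>Q\<close>,
      so the inverse of the Schreier generator at \<open>(?Q, s)\<close> handles the step by
      \<open>inv s\<close>.\<close>
    let ?Q = "H #> (r Q \<otimes> inv s)"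
    have "r Q \<otimes> inv s \<in> B"
      using r x sB B by (simp add: subgroup.m_closed subgroup.m_inv_closed)
    then have Q: "?Q \<in> ?P" by blast
    have "H #> (r ?Q \<otimes> s) = (H #> r ?Q) #> s"
      using r(1)[OF Q] Bc sB Hc by (simp add: coset_mult_assoc)
    also have "\<dots> = Q"
      unfolding r(2)[OF Q] using r[OF x(2)] Bc sB Hc by (simp add: coset_mult_assoc m_assoc)
    finally have "?g (?Q, s) = r ?Q \<otimes> s \<otimes> inv (r Q)" by simp
    moreover have "?g (?Q, s) \<in> generate G Z" using Q s unfolding Z_def by (intro generate.incl) blast
    ultimately have "inv (r ?Q \<otimes> s \<otimes> inv (r Q)) \<in> generate G Z"
      using generate_m_inv_closed[OF Zc] by metis
    then have "x \<otimes> inv (r ?Q \<otimes> s \<otimes> inv (r Q)) \<in> generate G Z" using x by (auto intro: generate.eng)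
    moreover have "d \<otimes> inv s = (x \<otimes> inv (r ?Q \<otimes> s \<otimes> inv (r Q))) \<otimes> r ?Q"
      using x gc r[OF Q] r[OF x(2)] Bc sB by (simp add: m_assoc inv_mult_group)
    ultimately show ?thesis using Q by blast
  qed
  have gen: "d \<otimes> y \<in> ?D" if "y \<in> generate G S" "d \<in> ?D" for d y
    using that
  proof (induction arbitrary: d)
    case one
    then have "d \<in> carrier G" using gc r Bc by auto
    with one show ?case by simp
  next
    case (eng h1 h2)
    have "d \<in> carrier G" using eng.prems gc r Bc by auto
    moreover have "h1 \<in> carrier G" "h2 \<in> carrier G" using eng.hyps S Bc by auto
    ultimately have "d \<otimes> (h1 \<otimes> h2) = d \<otimes> h1 \<otimes> h2" by (simp add: m_assoc)
    then show ?case using eng.IH eng.prems by simp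
  qed (use right rightinv in auto)
  have "\<one> = \<one> \<otimes> r H" by (simp add: r_def)
  then have one: "\<one> \<in> ?D" using HP generate.one by blast
  have BD: "B \<subseteq> ?D"
  proof
    fix b assume b: "b \<in> B"
    then have "\<one> \<otimes> b \<in> ?D" using gen[OF _ one] S(3) by blast
    then show "b \<in> ?D" unfolding l_one[OF Bc[OF b]] .
  qed
  have GZ: "generate G Z \<subseteq> H" using generate_subgroup_incl[OF ZH H] .
  have "H \<subseteq> generate G Z"
  proof
    fix h assume h: "h \<in> H"
    then obtain x Q where x: "x \<in> generate G Z" "Q \<in> ?P" "h = x \<otimes> r Q" using HB BD by blast
    have rc: "r Q \<in> carrier G" using r x Bc by blast
    have "r Q = inv x \<otimes> h" using x gc rc by (simp add: m_assoc[symmetric])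
    moreover have "inv x \<otimes> h \<in> H"
      using x(1) h GZ subgroup.m_closed[OF H] subgroup.m_inv_closed[OF H] by blast
    ultimately have "r Q \<in> H" by metis
    then have "H #> r Q = H" using rc H by (simp add: coset_join2)
    then have "Q = H" using r x by simp
    then show "h \<in> generate G Z" using x gc by (simp add: r_def)
  qed
  show thesis
  proof
    show "finite Z" unfolding Z_def using fin S by simp
    have "card Z \<le> card (?P \<times> S)" unfolding Z_def using fin S by (intro card_image_le) simp
    then show "card Z \<le> coset_count G H B * card S"
      unfolding coset_count_def by (simp add: card_cartesian_product)
    show "generate G Z = H" using GZ \<open>H \<subseteq> generate G Z\<close> by blast
  qed
qed

lemma rank_gradient_le_card:
  assumes L: "subgroup L G" "fin_index G L" and S: "finite S" "generate G S = L"
  shows "rank_gradient G * real (grp_index G L) \<le> real (card S)"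
proof -
  let ?q = "\<lambda>U. (real (min_gens G U) - 1) / real (grp_index G U)"
  have "rank_gradient G \<le> ?q L"
    unfolding rank_gradient_def
  proof (rule cInf_lower)
    show "?q L \<in> {?q U |U. subgroup U G \<and> fin_index G U}" using L by blast
    \<comment> \<open>\<open>min_gens\<close> may be 0, so the quotient can be negative; since the
      index is at least 1, it never drops below -1.\<close>
    have "-1 \<le> ?q U" if "fin_index G U" for U
      using grp_index_pos[OF that] by (simp add: field_simps)
    then show "bdd_below {?q U |U. subgroup U G \<and> fin_index G U}"
      by (intro bdd_belowI[of _ "-1"]) auto
  qed
  then have "rank_gradient G * real (grp_index G L) \<le> real (min_gens G L) - 1"
    using grp_index_pos[OF L(2)] by (simp add: field_simps)
  moreover have "min_gens G L \<le> card S"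
    unfolding min_gens_def using S by (intro Least_le exI[of _ S]) (auto intro: generate.incl)
  ultimately show ?thesis by simp
qed

lemma generate_Un_generate:
  assumes "S \<subseteq> carrier G" "T \<subseteq> carrier G"
  shows "generate G (generate G S \<union> generate G T) = generate G (S \<union> T)"
proof
  have "generate G S \<union> generate G T \<subseteq> generate G (S \<union> T)"
    using mono_generate[of S "S \<union> T"] mono_generate[of T "S \<union> T"] by blast
  then show "generate G (generate G S \<union> generate G T) \<subseteq> generate G (S \<union> T)"
    using assms by (intro generate_subgroup_incl generate_is_subgroup) auto
  show "generate G (S \<union> T) \<subseteq> generate G (generate G S \<union> generate G T)"
    by (intro mono_generate) (auto intro: generate.incl)
qed

lemma join_generators:
  assumes A: "subgroup A G" "finite S" "generate G S = A"
    and B: "subgroup B G" "finite T" "generate G T = B"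
    and A': "subgroup A' G" "A' \<subseteq> A" "finite ((\<lambda>x. A' #> x) ` A)"
    and B': "subgroup B' G" "B' \<subseteq> B" "finite ((\<lambda>x. B' #> x) ` B)"
  obtains Y where "finite Y" "generate G Y = generate G (A' \<union> B')"
    "card Y \<le> coset_count G A' A * card S + coset_count G B' B * card T"
proof -
  have ST: "S \<subseteq> A" "T \<subseteq> B" using A B by (auto intro: generate.incl)
  obtain Y where Y: "finite Y" "card Y \<le> coset_count G A' A * card S" "generate G Y = A'"
    using schreier_generators[OF A'(1) A(1) A'(2,3) A(2) ST(1) A(3)] .
  obtain Z where Z: "finite Z" "card Z \<le> coset_count G B' B * card T" "generate G Z = B'"
    using schreier_generators[OF B'(1) B(1) B'(2,3) B(2) ST(2) B(3)] .
  have "Y \<subseteq> A'" "Z \<subseteq> B'" using Y Z by (auto intro: generate.incl)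
  then have "Y \<subseteq> carrier G" "Z \<subseteq> carrier G"
    using subgroup.subset[OF A'(1)] subgroup.subset[OF B'(1)] by auto
  then have gen: "generate G (Y \<union> Z) = generate G (A' \<union> B')"
    using generate_Un_generate[of Y Z] Y Z by auto
  show thesis
    by (rule that[OF _ gen]) (use Y Z card_Un_le[of Y Z] in auto)
qed

text \<open>If <A', B'> has finite index, that index is at least [G : W], so many generators are
  required, while Schreier's bound supplies few. It is used twice to refute finite index: with
  \<open>W\<close> an intersection U \<inter> V, and with \<open>W\<close> of the form N A and
  \<open>A' = A\<close>.\<close>

lemma rank_gradient_join:
  assumes A: "subgroup A G" "finite S" "generate G S = A"
    and B: "subgroup B G" "finite T" "generate G T = B"
    and A': "subgroup A' G" "A' \<subseteq> A" "finite ((\<lambda>x. A' #> x) ` A)"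
    and B': "subgroup B' G" "B' \<subseteq> B" "finite ((\<lambda>x. B' #> x) ` B)"
    and W: "subgroup W G" "A' \<subseteq> W" "B' \<subseteq> W"
    and fin: "fin_index G (generate G (A' \<union> B'))" and "rank_gradient G \<ge> 0"
  shows "rank_gradient G * real (grp_index G W)
           \<le> real (coset_count G A' A * card S + coset_count G B' B * card T)"
proof -
  obtain Y where Y: "finite Y" "generate G Y = generate G (A' \<union> B')"
    "card Y \<le> coset_count G A' A * card S + coset_count G B' B * card T"
    using join_generators[OF A B A' B'] .
  let ?L = "generate G (A' \<union> B')"
  have L: "subgroup ?L G"
    using subgroup.subset[OF A'(1)] subgroup.subset[OF B'(1)] by (intro generate_is_subgroup) auto
  have "?L \<subseteq> W" using W by (intro generate_subgroup_incl) auto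
  then have "grp_index G W \<le> grp_index G ?L"
    unfolding grp_index_eq_coset_count
    using fin by (intro coset_count_antimono[OF L W(1)]) (auto simp: fin_index_iff)
  then have "rank_gradient G * real (grp_index G W) \<le> rank_gradient G * real (grp_index G ?L)"
    using assms by (intro mult_left_mono) auto
  also have "\<dots> \<le> real (card Y)"
    using rank_gradient_le_card[OF L fin Y(1,2)] .
  finally show ?thesis using Y(3) by linarith
qed

section \<open>LERF and finite index subgroups of large index\<close>

text \<open>If the indices were bounded, some finite index \<open>U\<close> containing
  \<open>A\<close> would have the greatest one. Intersecting \<open>U\<close> with a member of the
  family that cuts out \<open>A\<close> cannot raise the index, so \<open>U\<close> lies in every
  member, and \<open>U = A\<close> has finite index.\<close>

lemma LERF_large_index:
  assumes "LERF G" and A: "fg_subgroup G A" "\<not> fin_index G A"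
  obtains U where "subgroup U G" "fin_index G U" "A \<subseteq> U" "grp_index G U > n"
proof (rule ccontr)
  let ?P = "\<lambda>U. subgroup U G \<and> fin_index G U \<and> A \<subseteq> U"
  assume "\<not> thesis"
  then have bound: "\<forall>U. ?P U \<longrightarrow> grp_index G U < Suc n"
    using that by (meson not_less_eq)
  obtain \<K> where K: "\<forall>K\<in>\<K>. subgroup K G \<and> fin_index G K" "A = carrier G \<inter> \<Inter>\<K>"
    using assms unfolding LERF_def by blast
  have Ac: "A \<subseteq> carrier G" using K by blast
  have "(\<lambda>x. carrier G #> x) ` carrier G \<subseteq> {carrier G}"
    using coset_join2[OF _ subgroup_self] by auto
  then have "?P (carrier G)"
    unfolding fin_index_iff using Ac subgroup_self by (auto intro: finite_subset)
  then obtain U where U: "?P U" and max: "\<And>V. ?P V \<Longrightarrow> grp_index G V \<le> grp_index G U"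
    using ex_has_greatest_nat[of ?P "carrier G" "grp_index G" "Suc n"] bound by blast
  have "U \<subseteq> K" if "K \<in> \<K>" for K
  proof
    fix x assume x: "x \<in> U"
    have PK: "subgroup K G" "fin_index G K" "A \<subseteq> K" using K that by auto
    have UK: "subgroup (U \<inter> K) G" using U PK by (simp add: subgroups_Inter_pair)
    have P: "?P (U \<inter> K)" using U PK UK fin_index_Int by auto
    \<comment> \<open>By the tower law the left side is [G : U \<inter> K], so maximality forces
      [U : U \<inter> K] to be at most 1.\<close>
    have "grp_index G U * coset_count G (U \<inter> K) U \<le> grp_index G U"
      using max[OF P] grp_index_mult[OF UK _ Int_lower1] U by metis
    then have count: "card ((\<lambda>x. (U \<inter> K) #> x) ` U) \<le> Suc 0"
      using grp_index_pos U unfolding coset_count_def by auto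
    have "U \<subseteq> carrier G" using U by (auto dest: subgroup.subset)
    then have fin: "finite ((\<lambda>x. (U \<inter> K) #> x) ` U)"
      using P by (intro finite_rcos_subset) auto
    have "\<one> \<in> U" using U by (auto dest: subgroup.one_closed)
    then have "(U \<inter> K) #> x = (U \<inter> K) #> \<one>"
      using x count unfolding card_le_Suc0_iff_eq[OF fin] by blast
    then have "x \<otimes> inv \<one> \<in> U \<inter> K"
      using rcos_eq_iff[OF UK] x \<open>U \<subseteq> carrier G\<close> by blast
    then show "x \<in> K" using x \<open>U \<subseteq> carrier G\<close> by auto
  qed
  moreover have "U \<subseteq> carrier G" using U by (auto dest: subgroup.subset)
  ultimately have "U \<subseteq> A" using K by blast
  then show False using U A by auto
qed

section \<open>Counting cosets of \<open>N\<close> in the product N A B\<close>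

text \<open>In (a k b)(a l b)^-1 the factor \<open>b\<close> cancels, leaving the conjugate of k
  l^-1 by \<open>a\<close>. As \<open>N\<close> is normal, k \<mapsto> a k b therefore respects
  cosets of \<open>N\<close>.\<close>

lemma coset_count_two_sided_translate:
  assumes N: "N \<lhd> G" and "fin_index G N" and K: "K \<subseteq> carrier G"
    and ab: "a \<in> carrier G" "b \<in> carrier G"
  shows "coset_count G N ((\<lambda>k. a \<otimes> k \<otimes> b) ` K) \<le> coset_count G N K"
  unfolding coset_count_def image_image
proof (rule card_image_factor)
  show "finite ((\<lambda>k. N #> k) ` K)" using assms by (intro finite_rcos_subset)
  fix k l assume k: "k \<in> K" and l: "l \<in> K" and e: "N #> k = N #> l"
  have sub: "subgroup N G" using N by (rule normal_imp_subgroup)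
  have kl: "k \<in> carrier G" "l \<in> carrier G" using k l K by auto
  then have "k \<otimes> inv l \<in> N" using e rcos_eq_iff[OF sub] by simp
  then have "a \<otimes> (k \<otimes> inv l) \<otimes> inv a \<in> N" using N ab normal_inv_iff by blast
  moreover have "b \<otimes> (inv b \<otimes> y) = y" if "y \<in> carrier G" for y
    using that ab by (simp add: m_assoc[symmetric])
  then have "a \<otimes> (k \<otimes> inv l) \<otimes> inv a = (a \<otimes> k \<otimes> b) \<otimes> inv (a \<otimes> l \<otimes> b)"
    using ab kl by (simp add: m_assoc inv_mult_group)
  ultimately show "N #> (a \<otimes> k \<otimes> b) = N #> (a \<otimes> l \<otimes> b)"
    using rcos_eq_iff[OF sub] ab kl by simp
qed

lemma subset_set_mult:
  assumes "subgroup H G" "subgroup K G"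
  shows subset_set_mult_left: "H \<subseteq> H <#> K" and subset_set_mult_right: "K \<subseteq> H <#> K"
proof -
  have "h \<otimes> \<one> \<in> H <#> K" if "h \<in> H" for h
    using that subgroup.one_closed[OF assms(2)] unfolding set_mult_def by blast
  then show "H \<subseteq> H <#> K" using subgroup.mem_carrier[OF assms(1)] by auto
  have "\<one> \<otimes> k \<in> H <#> K" if "k \<in> K" for k
    using that subgroup.one_closed[OF assms(1)] unfolding set_mult_def by blast
  then show "K \<subseteq> H <#> K" using subgroup.mem_carrier[OF assms(2)] by auto
qed

text \<open>The saturated set \<open>N A B\<close> consists of \<open>[N A : N]\<close> cosets of \<open>N\<close> for each coset of \<open>N A\<close>
  meeting \<open>B\<close>; it is covered by the sets \<open>a\<^sup>-\<^sup>1 K b\<close>, each consisting of \<open>[K : N]\<close> cosets of \<open>N\<close>.\<close>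

lemma coset_count_normal_mult_le:
  assumes N: "N \<lhd> G" "fin_index G N" and A: "subgroup A G" and B: "subgroup B G"
    and K: "subgroup K G" "N \<subseteq> K"
    and R: "finite R" "R \<subseteq> carrier G" "\<And>x. x \<in> A \<Longrightarrow> \<exists>h\<in>K. \<exists>a\<in>R. x = h \<otimes> a"
    and T: "finite T" "T \<subseteq> carrier G" "\<And>x. x \<in> B \<Longrightarrow> \<exists>h\<in>K. \<exists>b\<in>T. x = h \<otimes> b"
  shows "coset_count G (N <#> A) B * grp_index G K \<le> card R * card T * grp_index G (N <#> A)"
proof -
  let ?U = "N <#> A"
  let ?D = "?U <#> B"
  have Ns: "subgroup N G" using N(1) by (rule normal_imp_subgroup)
  have U: "subgroup ?U G" using mult_norm_subgroup[OF N(1) A] .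
  have Kc: "K \<subseteq> carrier G" using subgroup.subset[OF K(1)] .
  have Ac: "A \<subseteq> carrier G" using subgroup.subset[OF A] .
  have Bc: "B \<subseteq> carrier G" using subgroup.subset[OF B] .
  have Uc: "?U \<subseteq> carrier G" using subgroup.subset[OF U] .
  have Nc: "N \<subseteq> carrier G" using subgroup.subset[OF Ns] .
  have NU: "N \<subseteq> ?U" using subset_set_mult_left[OF Ns A] .
  have Dc: "?D \<subseteq> carrier G" using setmult_subset_G Uc Bc by blast
  have "coset_count G N ?D = coset_count G ?U ?D * coset_count G N ?U"
  proof (rule coset_count_mult[OF Ns U NU Dc])
    fix u x assume u: "u \<in> ?U" and "x \<in> ?D"
    then obtain v b where v: "v \<in> ?U" "b \<in> B" "x = v \<otimes> b" unfolding set_mult_def[of _ ?U B] by blast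
    have "u \<otimes> x = (u \<otimes> v) \<otimes> b" using u v Uc Bc by (simp add: m_assoc subset_iff)
    moreover have "u \<otimes> v \<in> ?U" using subgroup.m_closed[OF U u v(1)] .
    ultimately show "u \<otimes> x \<in> ?D" using v(2) unfolding set_mult_def[of _ ?U B] by blast
  qed
  moreover have "(\<lambda>x. ?U #> x) ` ?D = (\<lambda>x. ?U #> x) ` B"
  proof -
    have *: "?U #> (u \<otimes> b) = ?U #> b" if "u \<in> ?U" "b \<in> B" for u b
    proof -
      have "?U #> (u \<otimes> b) = (?U #> u) #> b"
        using that Uc Bc by (simp add: coset_mult_assoc subset_iff)
      also have "?U #> u = ?U" using that Uc by (intro coset_join2[OF _ U]) auto
      finally show ?thesis .
    qed
    have "B \<subseteq> ?D" using subset_set_mult_right[OF U B] .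
    moreover have "?U #> d \<in> (\<lambda>x. ?U #> x) ` B" if "d \<in> ?D" for d
      using that * unfolding set_mult_def[of _ ?U B] by blast
    ultimately show ?thesis by blast
  qed
  ultimately have 1: "coset_count G N ?D = coset_count G ?U B * coset_count G N ?U"
    unfolding coset_count_def by simp
  let ?E = "\<lambda>(a, b). (\<lambda>k. inv a \<otimes> k \<otimes> b) ` K"
  have DE: "?D \<subseteq> (\<Union>p\<in>R \<times> T. ?E p)"
  proof
    fix d assume "d \<in> ?D"
    then obtain n x y where n: "n \<in> N" "x \<in> A" "y \<in> B" "d = n \<otimes> x \<otimes> y"
      unfolding set_mult_def by blast
    \<comment> \<open>The transversal is applied to the inverse of \<open>x\<close>, so that
      \<open>x\<close> acquires its representative on the left and the elements of \<open>K\<close>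
      can meet in the middle.\<close>
    have "inv x \<in> A" using n A by (simp add: subgroup.m_inv_closed)
    then obtain h a where h: "h \<in> K" "a \<in> R" "inv x = h \<otimes> a" using R(3) by blast
    obtain l b where l: "l \<in> K" "b \<in> T" "y = l \<otimes> b" using n T(3) by blast
    have c: "n \<in> carrier G" "x \<in> carrier G" "h \<in> carrier G" "a \<in> carrier G" "l \<in> carrier G" "b \<in> carrier G"
      using n h l Nc Ac Kc R(2) T(2) by auto
    have x: "x = inv a \<otimes> inv h" using h(3) c by (metis inv_inv inv_mult_group)
    \<comment> \<open>Moving \<open>n\<close> to the right past a^-1 conjugates it by
      \<open>a\<close>, which keeps it in \<open>N\<close> and hence in \<open>K\<close>.\<close>
    let ?k = "(a \<otimes> n \<otimes> inv a) \<otimes> (inv h \<otimes> l)"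
    have "a \<otimes> n \<otimes> inv a \<in> K" using N(1) n(1) c K(2) normal_inv_iff by blast
    then have k: "?k \<in> K"
      using h l K(1) by (simp add: subgroup.m_closed subgroup.m_inv_closed)
    have "inv a \<otimes> (a \<otimes> y) = y" if "y \<in> carrier G" for y
      using that c by (simp add: m_assoc[symmetric])
    then have "d = inv a \<otimes> ?k \<otimes> b"
      unfolding n(4) x l(3) using c by (simp add: m_assoc)
    with k h(2) l(2) show "d \<in> (\<Union>p\<in>R \<times> T. ?E p)" by blast
  qed
  have fin: "finite ((\<lambda>x. N #> x) ` Z)" if "Z \<subseteq> carrier G" for Z
    using finite_rcos_subset[OF N(2) that] .
  have Ec: "?E p \<subseteq> carrier G" if "p \<in> R \<times> T" for p
    using that R(2) T(2) Kc by (auto simp: subset_iff)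
  have "coset_count G N ?D \<le> coset_count G N (\<Union>p\<in>R \<times> T. ?E p)"
    using Ec by (intro coset_count_mono[OF fin DE]) blast
  also have "\<dots> \<le> (\<Sum>p\<in>R \<times> T. coset_count G N (?E p))"
    unfolding coset_count_def image_UN using R(1) T(1) by (intro card_UN_le) simp
  also have "\<dots> \<le> (\<Sum>p\<in>R \<times> T. coset_count G N K)"
  proof (rule sum_mono)
    fix p assume p: "p \<in> R \<times> T"
    then obtain a b where "p = (a, b)" "a \<in> carrier G" "b \<in> carrier G" using R(2) T(2) by blast
    then show "coset_count G N (?E p) \<le> coset_count G N K"
      using coset_count_two_sided_translate[OF N Kc, of "inv a" b] by simp
  qed
  finally have 2: "coset_count G ?U B * coset_count G N ?U \<le> card R * card T * coset_count G N K"
    using 1 by (simp add: card_cartesian_product)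
  have iU: "grp_index G N = grp_index G ?U * coset_count G N ?U"
    using grp_index_mult[OF Ns U NU] .
  have iK: "grp_index G N = grp_index G K * coset_count G N K"
    using grp_index_mult[OF Ns K] .
  have pos: "grp_index G N > 0" using grp_index_pos[OF N(2)] .
  \<comment> \<open>Both sides are scaled by [G : N], which factors through N A and through
    \<open>K\<close>; this eliminates [N A : N] and [K : N].\<close>
  have "coset_count G ?U B * grp_index G K * grp_index G N
      = (coset_count G ?U B * coset_count G N ?U) * (grp_index G K * grp_index G ?U)"
    unfolding iU by (simp add: algebra_simps)
  also have "\<dots> \<le> (card R * card T * coset_count G N K) * (grp_index G K * grp_index G ?U)"
    using 2 by (rule mult_right_mono) simp
  also have "\<dots> = card R * card T * grp_index G ?U * grp_index G N"
    unfolding iK by (simp add: algebra_simps)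
  finally show ?thesis using pos by simp
qed

section \<open>From \<open>A'\<close> and \<open>B'\<close> to the subgroup \<open>H\<close>\<close>

text \<open>With W = U \<inter> V, both [A : A \<inter> V] and [B : B \<inter> U] are at most
  [G : W] / n, so the join has too few generators for finite index. Finite generation of the join is
  recorded because LERF is applied to it next.\<close>

lemma join_finite_index_subgroups_infinite_index:
  assumes "LERF G" and pos: "rank_gradient G > 0"
    and A: "fg_subgroup G A" "\<not> fin_index G A" and B: "fg_subgroup G B" "\<not> fin_index G B"
  obtains A' B' where
    "subgroup A' G" "A' \<subseteq> A" "finite ((\<lambda>x. A' #> x) ` A)"
    "subgroup B' G" "B' \<subseteq> B" "finite ((\<lambda>x. B' #> x) ` B)"
    "fg_subgroup G (generate G (A' \<union> B'))" "\<not> fin_index G (generate G (A' \<union> B'))"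
proof -
  obtain S where S: "subgroup A G" "finite S" "generate G S = A"
    using A unfolding fg_subgroup_def by blast
  obtain T where T: "subgroup B G" "finite T" "generate G T = B"
    using B unfolding fg_subgroup_def by blast
  let ?\<rho> = "rank_gradient G"
  obtain n :: nat where n: "real (card S + card T) / ?\<rho> < real n"
    using reals_Archimedean2 by blast
  then have n': "real (card S + card T) < ?\<rho> * real n"
    using pos by (simp add: field_simps)
  obtain U where U: "subgroup U G" "fin_index G U" "A \<subseteq> U" "grp_index G U > n"
    using LERF_large_index[OF assms(1) A] .
  obtain V where V: "subgroup V G" "fin_index G V" "B \<subseteq> V" "grp_index G V > n"
    using LERF_large_index[OF assms(1) B] .
  let ?W = "U \<inter> V" and ?A = "A \<inter> V" and ?B = "B \<inter> U"
  have W: "subgroup ?W G" "fin_index G ?W"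
    using U V fin_index_Int by (auto simp: subgroups_Inter_pair)
  have c: "A \<subseteq> carrier G" "B \<subseteq> carrier G" "U \<subseteq> carrier G" "V \<subseteq> carrier G"
    using subgroup.subset[OF S(1)] subgroup.subset[OF T(1)] subgroup.subset[OF U(1)] subgroup.subset[OF V(1)] .
  have A': "subgroup ?A G" "?A \<subseteq> A" "finite ((\<lambda>x. ?A #> x) ` A)"
    using S(1) V(1) coset_count_Int(2)[OF S(1) V(1)] finite_rcos_subset[OF V(2) c(1)]
    by (auto simp: subgroups_Inter_pair)
  have B': "subgroup ?B G" "?B \<subseteq> B" "finite ((\<lambda>x. ?B #> x) ` B)"
    using T(1) U(1) coset_count_Int(2)[OF T(1) U(1)] finite_rcos_subset[OF U(2) c(2)]
    by (auto simp: subgroups_Inter_pair)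
  let ?C = "generate G (?A \<union> ?B)"
  have Cs: "subgroup ?C G" using c by (intro generate_is_subgroup) auto
  obtain Y where "finite Y" "generate G Y = ?C"
    using join_generators[OF S T A' B'] .
  then have C: "fg_subgroup G ?C"
    unfolding fg_subgroup_def using Cs by (auto intro: generate.incl)
  have "\<not> fin_index G ?C"
  proof
    assume "fin_index G ?C"
    then have le: "?\<rho> * real (grp_index G ?W)
        \<le> real (coset_count G ?A A * card S + coset_count G ?B B * card T)"
      using U(3) V(3) pos by (intro rank_gradient_join[OF S T A' B' W(1)]) auto
    \<comment> \<open>Since \<open>A\<close> lies in \<open>U\<close>, it meets at most as many
      cosets of \<open>V\<close> as \<open>U\<close> does, namely [U : W].\<close>
    have "coset_count G ?A A = coset_count G V A" using coset_count_Int(1)[OF S(1) V(1)] .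
    also have "\<dots> \<le> coset_count G V U"
      using coset_count_mono[OF finite_rcos_subset[OF V(2) c(3)] U(3)] .
    also have "\<dots> = coset_count G ?W U" using coset_count_Int(1)[OF U(1) V(1)] by simp
    finally have "n * coset_count G ?A A \<le> grp_index G U * coset_count G ?W U"
      using U(4) by (intro mult_le_mono) auto
    then have a: "n * coset_count G ?A A \<le> grp_index G ?W"
      using grp_index_mult[OF W(1) U(1) Int_lower1] by simp
    have "coset_count G ?B B = coset_count G U B" using coset_count_Int(1)[OF T(1) U(1)] .
    also have "\<dots> \<le> coset_count G U V"
      using coset_count_mono[OF finite_rcos_subset[OF U(2) c(4)] V(3)] .
    also have "\<dots> = coset_count G ?W V"
      using coset_count_Int(1)[OF V(1) U(1)] by (simp add: Int_commute)
    finally have "n * coset_count G ?B B \<le> grp_index G V * coset_count G ?W V"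
      using V(4) by (intro mult_le_mono) auto
    then have b: "n * coset_count G ?B B \<le> grp_index G ?W"
      using grp_index_mult[OF W(1) V(1) Int_lower2] by simp
    have "n * (coset_count G ?A A * card S + coset_count G ?B B * card T)
        = (n * coset_count G ?A A) * card S + (n * coset_count G ?B B) * card T"
      by (simp add: algebra_simps)
    also have "\<dots> \<le> grp_index G ?W * card S + grp_index G ?W * card T"
      using a b by (intro add_mono mult_right_mono) auto
    finally have "n * (coset_count G ?A A * card S + coset_count G ?B B * card T)
        \<le> grp_index G ?W * (card S + card T)" by (simp add: algebra_simps)
    then have "real n * real (coset_count G ?A A * card S + coset_count G ?B B * card T)
        \<le> real (grp_index G ?W) * real (card S + card T)"
      by (metis of_nat_le_iff of_nat_mult)
    moreover have "real n * (?\<rho> * real (grp_index G ?W))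
        \<le> real n * real (coset_count G ?A A * card S + coset_count G ?B B * card T)"
      using le by (intro mult_left_mono) auto
    ultimately have "real (grp_index G ?W) * (?\<rho> * real n) \<le> real (grp_index G ?W) * real (card S + card T)"
      by (simp add: algebra_simps)
    then have "?\<rho> * real n \<le> real (card S + card T)"
      using grp_index_pos[OF W(2)] by simp
    with n' show False by simp
  qed
  then show thesis using that[OF A' B' C] by blast
qed

end

theorem theorem1p1:
  fixes G :: "('a, 'b) monoid_scheme" and A B :: "'a set"
  assumes "group G" and "fg_group G" and "LERF G" and "rank_gradient G > 0"
    and "fg_subgroup G A" and "\<not> fin_index G A"
    and "fg_subgroup G B" and "\<not> fin_index G B"
  shows "\<exists>H. subgroup H G \<and> H \<subseteq> B \<and> fin_index_in G B H \<and>
             \<not> fin_index G (generate G (A \<union> H))"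
proof -
  interpret group G by fact
  obtain S where S: "subgroup A G" "finite S" "generate G S = A"
    using assms(5) unfolding fg_subgroup_def by blast
  obtain T where T: "subgroup B G" "finite T" "generate G T = B"
    using assms(7) unfolding fg_subgroup_def by blast
  have Ac: "A \<subseteq> carrier G" using subgroup.subset[OF S(1)] .
  have Bc: "B \<subseteq> carrier G" using subgroup.subset[OF T(1)] .
  obtain A' B' where A': "subgroup A' G" "A' \<subseteq> A" "finite ((\<lambda>x. A' #>\<^bsub>G\<^esub> x) ` A)"
    and B': "subgroup B' G" "B' \<subseteq> B" "finite ((\<lambda>x. B' #>\<^bsub>G\<^esub> x) ` B)"
    and C: "fg_subgroup G (generate G (A' \<union> B'))" "\<not> fin_index G (generate G (A' \<union> B'))"
    using join_finite_index_subgroups_infinite_index[OF assms(3-8)] .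
  \<comment> \<open>Because \<open>K\<close> will contain \<open>A'\<close> and \<open>B'\<close>,
    these transversals serve for every such \<open>K\<close>; their sizes are fixed before
    \<open>K\<close> is chosen.\<close>
  obtain P where P: "finite P" "P \<subseteq> A" "\<forall>x\<in>A. \<exists>h\<in>A'. \<exists>a\<in>P. x = h \<otimes>\<^bsub>G\<^esub> a"
    using finite_transversal[OF A'(1) S(1) A'(2,3)] .
  obtain Q where Q: "finite Q" "Q \<subseteq> B" "\<forall>x\<in>B. \<exists>h\<in>B'. \<exists>b\<in>Q. x = h \<otimes>\<^bsub>G\<^esub> b"
    using finite_transversal[OF B'(1) T(1) B'(2,3)] .
  \<comment> \<open>\<open>?c\<close> combines the number of sets a^-1 K b covering N A B with the
    number of generators of \<open>A\<close> and \<open>B\<close>.\<close>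
  let ?\<rho> = "rank_gradient G" and ?c = "card P * card Q * (card S + card T)"
  obtain n :: nat where "real ?c / ?\<rho> < real n"
    using reals_Archimedean2 by blast
  then have n: "real ?c < ?\<rho> * real n"
    using assms(4) by (simp add: field_simps)
  obtain K where K: "subgroup K G" "fin_index G K" "generate G (A' \<union> B') \<subseteq> K" "grp_index G K > n"
    using LERF_large_index[OF assms(3) C] .
  have "A' \<subseteq> K" "B' \<subseteq> K" using K(3) by (auto intro: generate.incl)
  obtain N where N: "N \<lhd> G" "N \<subseteq> K" "fin_index G N"
    using fin_index_normal_core[OF K(1,2)] .
  let ?U = "N <#>\<^bsub>G\<^esub> A"
  have U: "subgroup ?U G" using mult_norm_subgroup[OF N(1) S(1)] .
  have AU: "A \<subseteq> ?U" using subset_set_mult_right[OF normal_imp_subgroup[OF N(1)] S(1)] .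
  have "fin_index G ?U"
    using finite_rcos_antimono[OF normal_imp_subgroup[OF N(1)] U
        subset_set_mult_left[OF normal_imp_subgroup[OF N(1)] S(1)] subset_refl] N(3)
    unfolding fin_index_iff by blast
  \<comment> \<open>This choice keeps <A, H> inside N A, and [B : H] is the number of cosets of N A
    that meet \<open>B\<close>.\<close>
  define H where "H = B \<inter> ?U"
  have H: "subgroup H G" "H \<subseteq> B" "finite ((\<lambda>x. H #>\<^bsub>G\<^esub> x) ` B)"
    unfolding H_def using T(1) U coset_count_Int(2)[OF T(1) U] finite_rcos_subset[OF \<open>fin_index G ?U\<close> Bc]
    by (auto simp: subgroups_Inter_pair)
  have "coset_count G ?U B * grp_index G K \<le> card P * card Q * grp_index G ?U"
    using P Q \<open>A' \<subseteq> K\<close> \<open>B' \<subseteq> K\<close> Ac Bc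
    by (intro coset_count_normal_mult_le[OF N(1,3) S(1) T(1) K(1) N(2)]) blast+
  then have HK: "coset_count G H B * grp_index G K \<le> card P * card Q * grp_index G ?U"
    unfolding H_def using coset_count_Int(1)[OF T(1) U] by simp
  have "\<not> fin_index G (generate G (A \<union> H))"
  proof
    assume "fin_index G (generate G (A \<union> H))"
    moreover have AA: "(\<lambda>x. A #>\<^bsub>G\<^esub> x) ` A \<subseteq> {A}"
      using coset_join2[OF _ S(1)] Ac by blast
    ultimately have le: "?\<rho> * real (grp_index G ?U)
        \<le> real (coset_count G A A * card S + coset_count G H B * card T)"
      using AU assms(4) finite_subset[OF AA]
      by (intro rank_gradient_join[OF S T S(1) _ _ H U]) (auto simp: H_def)
    \<comment> \<open>Here \<open>A\<close> is kept whole, so its index 1 is dominated by [B : H],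
      and one factor [B : H] bounds both generator counts.\<close>
    have "coset_count G A A \<le> 1"
      unfolding coset_count_def using card_mono[OF _ AA] by simp
    moreover have "coset_count G H B \<ge> 1"
      unfolding coset_count_def using H(3) subgroup.one_closed[OF T(1)]
      by (auto simp: Suc_le_eq card_gt_0_iff)
    ultimately have "coset_count G A A * card S \<le> coset_count G H B * card S"
      by (intro mult_right_mono) auto
    then have "coset_count G A A * card S + coset_count G H B * card T
        \<le> coset_count G H B * (card S + card T)"
      by (simp add: algebra_simps)
    with le have "?\<rho> * real (grp_index G ?U) \<le> real (coset_count G H B * (card S + card T))"
      by linarith
    \<comment> \<open>Scaling by [G : K] makes \<open>HK\<close> applicable; afterwards [G : N A]
      cancels and contradicts the choice of \<open>n\<close>.\<close>
    then have "?\<rho> * real (grp_index G ?U) * real (grp_index G K)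
        \<le> real (coset_count G H B * (card S + card T)) * real (grp_index G K)"
      by (rule mult_right_mono) simp
    also have "\<dots> = real ((coset_count G H B * grp_index G K) * (card S + card T))"
      by simp
    also have "\<dots> \<le> real ((card P * card Q * grp_index G ?U) * (card S + card T))"
      using HK by (intro of_nat_mono mult_right_mono) auto
    also have "\<dots> = real ?c * real (grp_index G ?U)" by simp
    finally have "(?\<rho> * real (grp_index G K)) * real (grp_index G ?U) \<le> real ?c * real (grp_index G ?U)"
      by (simp add: algebra_simps)
    then have "?\<rho> * real (grp_index G K) \<le> real ?c"
      using grp_index_pos[OF \<open>fin_index G ?U\<close>] by simp
    moreover have "?\<rho> * real n \<le> ?\<rho> * real (grp_index G K)"
      using K(4) assms(4) by (intro mult_left_mono) auto
    ultimately show False using n by simp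
  qed
  with H show ?thesis unfolding fin_index_in_iff by blast
qed

end
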